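(* Let $t\ge 2$ and $k\ge 2$ be integers and let $H$ be a (finite or infinite) acyclic $t$-uniform hypergraph with maximum degree at most $k$. Then $$\rho(H)\ \le\ \frac{t}{t-1}\bigl((t-1)(k-1)\bigr)^{1/t}.$$
   Context: A hypergraph $H=(V,E)$ consists of a (nonempty, finite or countably infinite) vertex set $V=V(H)$ and a set $E=E(H)$ of subsets of $V$, called edges (no multiple edges). It is $t$-uniform if every edge has exactly $t$ vertices. The degree of a vertex $v$ is the number of edges containing $v$; infinite hypergraphs are assumed locally finite (every degree is finite). The Levi graph $L(H)$ of $H$ is the graph with vertex set $V(H)\cup E(H)$ (disjoint union) in which each $e\in E(H)$ is adjacent to exactly the vertices $v\in e$. $H$ is acyclic if $L(H)$ is a forest. The adjacency tensor of a $t$-uniform hypergraph $H$ is the order-$t$ symmetric tensor $\mathcal A=(\mathcal A_{v_1\cdots v_t})_{v_1,\dots,v_t\in V}$ with $\mathcal A_{v_1\cdots v_t}=\frac1{(t-1)!}$ if $\{v_1,\dots,v_t\}\in E$ and $0$ otherwise. For a tensor $\mathcal T$ of order $t$ over a finite set $U$ and $x\in\mathbb C^U$, let $(\mathcal Tx)_v=\sum_{v_2,\dots,v_t\in U}\mathcal T_{vv_2\cdots v_t}x_{v_2}\cdots x_{v_t}$. A number $\lambda\in\mathbb C$ is an eigenvalue of $\mathcal T$ if there is $0\ne x\in\mathbb C^U$ with $(\mathcal Tx)_v=\lambda x_v^{t-1}$ for all $v\in U$; the spectral radius $\rho(\mathcal T)$ of a nonnegative tensor $\mathcal T$ over a finite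 set is the maximum of $|\lambda|$ over its eigenvalues. If $\mathcal T$ is a nonnegative tensor over an infinite set $V$, then $\rho(\mathcal T)=\sup\{\rho(\mathcal T_U): U\subset V,\ U\text{ finite}\}$, where $\mathcal T_U$ is the restriction of $\mathcal T$ to $t$-tuples of elements of $U$. The spectral radius of $H$ is $\rho(H)=\rho(\mathcal A)$. For finite $H$ this agrees with $\rho(H)=\sup\{|\tau_H(x_1,\dots,x_t)| : x_i\in\mathbb C^V,\ \|x_i\|_t=1\}$, where $\tau_H$ is the $t$-linear form on $\mathbb C^V$ with coefficients $\mathcal A_{v_1\cdots v_t}$ in the standard basis and $\|x\|_t=(\sum_v|x_v|^t)^{1/t}$. *)

theory Defs
  imports "HOL-Library.Countable_Set" "HOL-Library.Extended_Nonnegative_Real" Complex_Main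
begin

section \<open>Graphs\<close>

text \<open>A simple graph is given by a vertex set \<open>W\<close> and a set \<open>F\<close> of two-element subsets of \<open>W\<close>.
  A cycle is the cyclic sequence of its vertices, at least three and pairwise distinct.\<close>

definition is_cycle :: "'v set \<Rightarrow> 'v set set \<Rightarrow> 'v list \<Rightarrow> bool" where
  "is_cycle W F p \<longleftrightarrow> length p \<ge> 3 \<and> distinct p \<and> set p \<subseteq> W \<and>
     (\<forall>i<length p. {p ! i, p ! (Suc i mod length p)} \<in> F)"

definition is_forest :: "'v set \<Rightarrow> 'v set set \<Rightarrow> bool" where
  "is_forest W F \<longleftrightarrow> (\<nexists>p. is_cycle W F p)"

section \<open>Hypergraphs\<close>

text \<open>For finite \<open>V\<close> the last two assumptions hold automatically.\<close>

locale hypergraph =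
  fixes V :: "'a set" and E :: "'a set set"
  assumes vertices_nonempty: "V \<noteq> {}"
    and edges_subset: "e \<in> E \<Longrightarrow> e \<subseteq> V"
    and vertices_countable: "countable V"
    and locally_finite: "v \<in> V \<Longrightarrow> finite {e \<in> E. v \<in> e}"

definition uniform_hypergraph :: "nat \<Rightarrow> 'a set set \<Rightarrow> bool" where
  "uniform_hypergraph t E \<longleftrightarrow> (\<forall>e\<in>E. finite e \<and> card e = t)"

definition vertex_degree :: "'a set set \<Rightarrow> 'a \<Rightarrow> nat" where
  "vertex_degree E v = card {e \<in> E. v \<in> e}"

definition levi_vertices :: "'a set \<Rightarrow> 'a set set \<Rightarrow> ('a + 'a set) set" where
  "levi_vertices V E = V <+> E"

definition levi_edges :: "'a set \<Rightarrow> 'a set set \<Rightarrow> ('a + 'a set) set set" where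
  "levi_edges V E = {{Inl v, Inr e} | v e. v \<in> V \<and> e \<in> E \<and> v \<in> e}"

definition acyclic_hypergraph :: "'a set \<Rightarrow> 'a set set \<Rightarrow> bool" where
  "acyclic_hypergraph V E \<longleftrightarrow> is_forest (levi_vertices V E) (levi_edges V E)"

section \<open>Tensors and their spectral radius\<close>

text \<open>A tensor of order \<open>t\<close> over \<open>U\<close> is a function on lists, of which only the values at lists of
  length \<open>t\<close> with entries in \<open>U\<close> matter. Since \<open>U\<close> is an explicit argument below, restricting a
  tensor to a smaller set only means changing that argument. Likewise a vector of
  \<open>\<complex>\<^sup>U\<close> is a function of which only the values on \<open>U\<close> matter.\<close>

definition tensor_apply ::
  "nat \<Rightarrow> 'a set \<Rightarrow> ('a list \<Rightarrow> complex) \<Rightarrow> ('a \<Rightarrow> complex) \<Rightarrow> 'a \<Rightarrow> complex" where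
  "tensor_apply t U T x v =
     (\<Sum>vs\<in>{vs. set vs \<subseteq> U \<and> length vs = t - 1}. T (v # vs) * (\<Prod>w\<leftarrow>vs. x w))"

definition tensor_eigenvalue ::
  "nat \<Rightarrow> 'a set \<Rightarrow> ('a list \<Rightarrow> complex) \<Rightarrow> complex \<Rightarrow> bool" where
  "tensor_eigenvalue t U T \<mu> \<longleftrightarrow>
     (\<exists>x. (\<exists>v\<in>U. x v \<noteq> 0) \<and> (\<forall>v\<in>U. tensor_apply t U T x v = \<mu> * x v ^ (t - 1)))"

text \<open>The maximum of the moduli of the eigenvalues is written as a supremum; it is attained, as the
  set of eigenvalues of a tensor over a finite nonempty set is compact and nonempty. Over the empty
  set the value is 0. Extended values ensure
  that a supremum over infinitely many finite sets is meaningful even if it is infinite.\<close>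

definition spectral_radius_finite :: "nat \<Rightarrow> 'a set \<Rightarrow> ('a list \<Rightarrow> complex) \<Rightarrow> ennreal" where
  "spectral_radius_finite t U T = (SUP \<mu>\<in>{\<mu>. tensor_eigenvalue t U T \<mu>}. ennreal (cmod \<mu>))"

definition spectral_radius :: "nat \<Rightarrow> 'a set \<Rightarrow> ('a list \<Rightarrow> complex) \<Rightarrow> ennreal" where
  "spectral_radius t V T =
     (if finite V then spectral_radius_finite t V T
      else (SUP U\<in>{U. U \<subseteq> V \<and> finite U}. spectral_radius_finite t U T))"

definition adjacency_tensor :: "nat \<Rightarrow> 'a set set \<Rightarrow> 'a list \<Rightarrow> complex" where
  "adjacency_tensor t E vs = (if set vs \<in> E then 1 / fact (t - 1) else 0)"

definition hypergraph_spectral_radius :: "nat \<Rightarrow> 'a set \<Rightarrow> 'a set set \<Rightarrow> ennreal" where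
  "hypergraph_spectral_radius t V E = spectral_radius t V (adjacency_tensor t E)"

end

theory Submission
  imports Defs "HOL-Analysis.Convex" "HOL-Combinatorics.Multiset_Permutations"
begin

text \<open>
  The eigenvalues of the adjacency tensor on a finite vertex set are bounded by weighting the
  incidences \<open>(v, e)\<close>. Suppose the weights \<open>B v e\<close> sum to at most 1 at every
  vertex and multiply to at least \<open>\<alpha>\<close> on every edge. Multiplying the eigenvalue equation
  at \<open>v\<close> by \<open>x v\<close>, taking absolute values and summing over \<open>v\<close> gives
  \<open>\<bar>\<mu>\<bar> \<Sum>\<^sub>v \<bar>x v\<bar>\<^sup>t \<le> t \<Sum>\<^sub>e \<Prod>\<^bsub>w \<in> e\<^esub> \<bar>x w\<bar>\<close>. The inequality of arithmetic and geometric
  means, applied on each edge to the numbers \<open>B w e \<bar>x w\<bar>\<^sup>t\<close>, bounds the right-hand side by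
  \<open>\<alpha>\<close> to the power \<open>-1/t\<close> times \<open>\<Sum>\<^sub>v \<bar>x v\<bar>\<^sup>t\<close>, so \<open>\<bar>\<mu>\<bar>\<close> to the power \<open>t\<close> is
  at most \<open>1/\<alpha>\<close> (lemma \<open>eigenvalue_bound_of_incidence_weights\<close>).

  Acyclicity supplies good weights. Rooting every component of the Levi graph at a vertex
  gives each edge a parent vertex, and each vertex is a child in at most one of its edges
  (lemma \<open>acyclic_parent_map\<close>, proved by removing leaf edges one at a time). Parent incidences
  receive the weight \<open>1 / (t (k - 1))\<close> and child incidences the weight \<open>(t - 1) / t\<close>.
  A vertex that is a child once then has total weight at most 1, with equality at degree
  \<open>k\<close>; a root has total weight at most \<open>k / (t (k - 1)) \<le> 1\<close>. An edge has one parent and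
  \<open>t - 1\<close> children, so its product is
  \<open>\<alpha> = ((t - 1) / t)\<^sup>t / ((t - 1) (k - 1))\<close>, whose power \<open>-1/t\<close> is the claimed bound.
  The spectral radius of an infinite hypergraph is a supremum over finite vertex sets, and the
  bound on each of them depends only on \<open>t\<close> and \<open>k\<close>.
\<close>

section \<open>Leaf edges and parent vertices\<close>

text \<open>The first vertex of a longest path has all its neighbours on the path. One of the two
  neighbours is not the second vertex, and the edge back from it closes a cycle.\<close>

lemma ex_cycle_of_two_neighbours:
  assumes "finite W" "W \<noteq> {}"
    and nb: "\<And>w. w \<in> W \<Longrightarrow> \<exists>a\<in>W. \<exists>b\<in>W. a \<noteq> b \<and> a \<noteq> w \<and> b \<noteq> w \<and> {w, a} \<in> F \<and> {w, b} \<in> F"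
  shows "\<exists>p. is_cycle W F p"
proof -
  define path where "path p \<longleftrightarrow> p \<noteq> [] \<and> distinct p \<and> set p \<subseteq> W \<and>
      (\<forall>i. Suc i < length p \<longrightarrow> {p ! i, p ! Suc i} \<in> F)" for p
  obtain w0 where "w0 \<in> W" using assms(2) by blast
  then have "path [w0]" by (simp add: path_def)
  moreover have "\<forall>p. path p \<longrightarrow> length p < Suc (card W)"
    by (metis assms(1) card_mono distinct_card path_def less_Suc_eq_le)
  ultimately obtain p where p: "path p" and longest: "\<And>q. path q \<Longrightarrow> length q \<le> length p"
    using ex_has_greatest_nat[of path "[w0]" length "Suc (card W)"] by metis
  obtain w q where wq: "p = w # q" using p by (cases p) (auto simp: path_def)
  have "w \<in> W" using p wq by (simp add: path_def)
  then obtain a b where ab: "a \<in> W" "b \<in> W" "a \<noteq> b" "a \<noteq> w" "b \<noteq> w" "{w, a} \<in> F" "{w, b} \<in> F"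
    using nb by blast
  have on_path: "c \<in> set p" if "c \<in> W" "{w, c} \<in> F" for c
  proof (rule ccontr)
    assume "c \<notin> set p"
    then have "path (c # p)"
      using p that wq by (auto simp: path_def nth_Cons insert_commute split: nat.splits)
    then show False using longest by fastforce
  qed
  obtain i j where ij: "i < length p" "p ! i = a" "j < length p" "p ! j = b"
    using on_path ab by (metis in_set_conv_nth)
  have "i \<noteq> j" "i \<noteq> 0" "j \<noteq> 0" using ij ab wq by (auto intro!: gr0I)
  then have "i \<ge> 2 \<or> j \<ge> 2" by linarith
  then obtain m where m: "m \<ge> 2" "m < length p" "{w, p ! m} \<in> F"
    using ij ab by blast
  have "is_cycle W F (take (Suc m) p)"
    unfolding is_cycle_def
  proof (intro conjI allI impI)
    show "3 \<le> length (take (Suc m) p)" using m by simp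
    show "distinct (take (Suc m) p)" using p by (simp add: path_def)
    show "set (take (Suc m) p) \<subseteq> W" using p set_take_subset by (fastforce simp: path_def)
    fix i assume "i < length (take (Suc m) p)"
    then have i: "i \<le> m" and len: "length (take (Suc m) p) = Suc m" using m by auto
    show "{take (Suc m) p ! i, take (Suc m) p ! (Suc i mod length (take (Suc m) p))} \<in> F"
    proof (cases "i = m")
      case True
      then show ?thesis unfolding len using m wq by (simp add: insert_commute)
    next
      case False
      then have "i < m" using i by simp
      then show ?thesis unfolding len using p m by (simp add: path_def)
    qed
  qed
  then show ?thesis ..
qed

text \<open>If every edge of \<open>C\<close> shared two of its vertices with other edges of \<open>C\<close>, then the shared
  vertices and the edges would induce a subgraph of the Levi graph in which every node has two
  neighbours.\<close>

lemma acyclic_ex_leaf_edge: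
  assumes acyc: "acyclic_hypergraph V E"
    and C: "finite C" "C \<noteq> {}" "C \<subseteq> E" and sub: "\<And>e. e \<in> C \<Longrightarrow> finite e \<and> e \<subseteq> V"
  obtains e where "e \<in> C"
    and "\<And>u v f g. \<lbrakk>u \<in> e; v \<in> e; f \<in> C; g \<in> C; f \<noteq> e; g \<noteq> e; u \<in> f; v \<in> g\<rbrakk> \<Longrightarrow> u = v"
proof (rule ccontr)
  assume no_leaf: "\<not> thesis"
  note leaf_edge = that
  have two_shared: "\<exists>u v f g. u \<in> e \<and> v \<in> e \<and> f \<in> C \<and> g \<in> C \<and> f \<noteq> e \<and> g \<noteq> e \<and> u \<in> f \<and> v \<in> g \<and> u \<noteq> v"
    if "e \<in> C" for e
    using no_leaf leaf_edge[of e] that by blast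
  define S where "S = {v. \<exists>e\<in>C. \<exists>f\<in>C. e \<noteq> f \<and> v \<in> e \<and> v \<in> f}"
  have "S \<subseteq> \<Union>C" by (auto simp: S_def)
  then have finS: "finite S" using C(1) sub by (meson finite_Union finite_subset)
  have SV: "S \<subseteq> V" using \<open>S \<subseteq> \<Union>C\<close> sub by blast
  let ?F = "levi_edges V E"
  have levi: "{Inl v, Inr e} \<in> ?F" "{Inr e, Inl v} \<in> ?F" if "e \<in> C" "v \<in> e" for e v
    using that C(3) sub[of e] by (auto simp: levi_edges_def insert_commute)
  have "\<exists>p. is_cycle (S <+> C) ?F p"
  proof (rule ex_cycle_of_two_neighbours)
    show "finite (S <+> C)" using finS C(1) by simp
    show "S <+> C \<noteq> {}" using C(2) by auto
    fix w assume "w \<in> S <+> C"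
    then show "\<exists>a\<in>S <+> C. \<exists>b\<in>S <+> C. a \<noteq> b \<and> a \<noteq> w \<and> b \<noteq> w \<and> {w, a} \<in> ?F \<and> {w, b} \<in> ?F"
    proof
      fix v assume v: "w = Inl v" "v \<in> S"
      then obtain e f where ef: "e \<in> C" "f \<in> C" "e \<noteq> f" "v \<in> e" "v \<in> f"
        by (auto simp: S_def)
      show ?thesis
        by (rule bexI[of _ "Inr e"], rule bexI[of _ "Inr f"])
          (simp_all add: v(1) ef levi(1) InrI)
    next
      fix e assume e: "w = Inr e" "e \<in> C"
      then obtain u v f g where uv: "u \<in> e" "v \<in> e" "f \<in> C" "g \<in> C" "f \<noteq> e" "g \<noteq> e"
          "u \<in> f" "v \<in> g" "u \<noteq> v"
        using two_shared[OF e(2)] by (elim exE conjE) (rule that)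
      have S: "u \<in> S" "v \<in> S" using e(2) uv by (auto simp: S_def)
      show ?thesis
        by (rule bexI[of _ "Inl u"], rule bexI[of _ "Inl v"])
          (simp_all add: e(1) S uv(9) levi(2)[OF e(2)] uv(1,2) InlI)
    qed
  qed
  then obtain p where "is_cycle (S <+> C) ?F p" ..
  moreover have "S <+> C \<subseteq> levi_vertices V E"
    using SV C(3) by (auto simp: levi_vertices_def)
  ultimately have "is_cycle (levi_vertices V E) ?F p"
    unfolding is_cycle_def by blast
  then show False using acyc by (auto simp: acyclic_hypergraph_def is_forest_def)
qed

text \<open>The map sends an edge to its parent in a rooted forest; the last conjunct says that no vertex
  is a child in two edges. A leaf edge can be added to any such map on the other
  edges by choosing as its parent the only vertex it shares with them, if there is one.\<close>

lemma acyclic_parent_map: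
  assumes acyc: "acyclic_hypergraph V E"
    and C: "finite C" "C \<subseteq> E" and sub: "\<And>e. e \<in> C \<Longrightarrow> finite e \<and> e \<subseteq> V \<and> e \<noteq> {}"
  shows "\<exists>p. (\<forall>e\<in>C. p e \<in> e) \<and>
    (\<forall>e\<in>C. \<forall>f\<in>C. \<forall>v. e \<noteq> f \<longrightarrow> v \<in> e \<longrightarrow> v \<in> f \<longrightarrow> p e = v \<or> p f = v)"
  using C sub
proof (induction C rule: finite_psubset_induct)
  case (psubset C)
  show ?case
  proof (cases "C = {}")
    case True
    then show ?thesis by simp
  next
    case False
    obtain e where e: "e \<in> C"
      and leaf: "\<And>u v f g. \<lbrakk>u \<in> e; v \<in> e; f \<in> C; g \<in> C; f \<noteq> e; g \<noteq> e; u \<in> f; v \<in> g\<rbrakk> \<Longrightarrow> u = v"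
      using acyclic_ex_leaf_edge[OF acyc psubset.hyps False] psubset.prems by metis
    have "\<exists>p. (\<forall>e\<in>C - {e}. p e \<in> e) \<and>
        (\<forall>f\<in>C - {e}. \<forall>g\<in>C - {e}. \<forall>v. f \<noteq> g \<longrightarrow> v \<in> f \<longrightarrow> v \<in> g \<longrightarrow> p f = v \<or> p g = v)"
      using e psubset.prems by (intro psubset.IH) auto
    then obtain p where p: "\<forall>e\<in>C - {e}. p e \<in> e"
      "\<And>f g v. \<lbrakk>f \<in> C - {e}; g \<in> C - {e}; f \<noteq> g; v \<in> f; v \<in> g\<rbrakk> \<Longrightarrow> p f = v \<or> p g = v"
      by metis
    obtain r where r: "r \<in> e" "\<And>v f. \<lbrakk>v \<in> e; f \<in> C; f \<noteq> e; v \<in> f\<rbrakk> \<Longrightarrow> r = v"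
    proof (cases "\<exists>v f. v \<in> e \<and> f \<in> C \<and> f \<noteq> e \<and> v \<in> f")
      case True
      then show ?thesis using that leaf by metis
    next
      case False
      then show ?thesis using that psubset.prems(2)[OF e] by blast
    qed
    show ?thesis
    proof (intro exI[of _ "p(e := r)"] conjI ballI allI impI)
      fix f assume "f \<in> C"
      then show "(p(e := r)) f \<in> f" using p(1) r(1) by simp
    next
      fix f g v assume fg: "f \<in> C" "g \<in> C" "f \<noteq> g" "v \<in> f" "v \<in> g"
      show "(p(e := r)) f = v \<or> (p(e := r)) g = v"
        using fg r(2)[of v f] r(2)[of v g] p(2)[of f g v] by (cases "f = e"; cases "g = e") simp_all
    qed
  qed
qed

section \<open>Eigenvalues and weighted incidences\<close>

text \<open>Since the edges are \<open>t\<close>-element sets, a list of length \<open>t\<close> whose entries form an edge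
  has no repetitions. Each edge containing \<open>v\<close> therefore comes from exactly \<open>(t - 1)!\<close> lists, which
  cancels the factor in the adjacency tensor.\<close>

lemma tensor_apply_adjacency_tensor:
  assumes U: "finite U" "v \<in> U" and t: "t \<ge> 1" and unif: "uniform_hypergraph t E"
  shows "tensor_apply t U (adjacency_tensor t E) x v =
    (\<Sum>e | e \<in> E \<and> e \<subseteq> U \<and> v \<in> e. \<Prod>w\<in>e - {v}. x w)"
proof -
  let ?L = "{vs. set vs \<subseteq> U \<and> length vs = t - 1}"
  let ?C = "{e. e \<in> E \<and> e \<subseteq> U \<and> v \<in> e}"
  have finL: "finite ?L" by (rule finite_lists_length_eq[OF U(1)])
  have finC: "finite ?C" by (rule finite_subset[of _ "Pow U"]) (use U in auto)
  have card_e: "finite e" "card e = t" if "e \<in> E" for e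
    using unif that by (auto simp: uniform_hypergraph_def)
  have lists: "{vs \<in> ?L. set (v # vs) \<in> E} = (\<Union>e\<in>?C. permutations_of_set (e - {v}))"
  proof (intro set_eqI iffI)
    fix vs assume vs: "vs \<in> {vs \<in> ?L. set (v # vs) \<in> E}"
    then have "card (set (v # vs)) = length (v # vs)" using card_e(2)[of "set (v # vs)"] t by simp
    then have "distinct (v # vs)" by (rule card_distinct)
    then have "vs \<in> permutations_of_set (set (v # vs) - {v})"
      by (auto simp: permutations_of_set_def)
    moreover have "set (v # vs) \<in> ?C" using vs U by auto
    ultimately show "vs \<in> (\<Union>e\<in>?C. permutations_of_set (e - {v}))" by blast
  next
    fix vs assume "vs \<in> (\<Union>e\<in>?C. permutations_of_set (e - {v}))"
    then obtain e where e: "e \<in> ?C" "vs \<in> permutations_of_set (e - {v})" by blast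
    then have "length vs = t - 1" using card_e[of e] length_finite_permutations_of_set[OF e(2)]
      by (simp add: card_Diff_singleton)
    moreover have "set vs = e - {v}" using e by (simp add: permutations_of_set_def)
    ultimately show "vs \<in> {vs \<in> ?L. set (v # vs) \<in> E}"
      using e by (auto simp: insert_absorb)
  qed
  have "tensor_apply t U (adjacency_tensor t E) x v
      = (\<Sum>vs\<in>?L. if set (v # vs) \<in> E then 1 / fact (t - 1) * (\<Prod>w\<leftarrow>vs. x w) else 0)"
    unfolding tensor_apply_def adjacency_tensor_def by (intro sum.cong) auto
  also have "\<dots> = (\<Sum>vs\<in>{vs \<in> ?L. set (v # vs) \<in> E}. 1 / fact (t - 1) * (\<Prod>w\<leftarrow>vs. x w))"
    by (rule sum.inter_filter[OF finL, symmetric])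
  also have "\<dots> = (\<Sum>e\<in>?C. \<Sum>vs\<in>permutations_of_set (e - {v}). 1 / fact (t - 1) * (\<Prod>w\<leftarrow>vs. x w))"
    unfolding lists
  proof (rule sum.UNION_disjoint[OF finC])
    show "\<forall>e\<in>?C. \<forall>f\<in>?C. e \<noteq> f \<longrightarrow> permutations_of_set (e - {v}) \<inter> permutations_of_set (f - {v}) = {}"
      by (auto simp: permutations_of_set_def)
  qed simp
  also have "\<dots> = (\<Sum>e\<in>?C. \<Prod>w\<in>e - {v}. x w)"
  proof (rule sum.cong)
    fix e assume e: "e \<in> ?C"
    have "(\<Sum>vs\<in>permutations_of_set (e - {v}). 1 / fact (t - 1) * (\<Prod>w\<leftarrow>vs. x w))
        = (\<Sum>vs\<in>permutations_of_set (e - {v}). 1 / fact (t - 1) * (\<Prod>w\<in>e - {v}. x w))"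
    proof (rule sum.cong[OF refl])
      fix vs assume "vs \<in> permutations_of_set (e - {v})"
      then show "1 / fact (t - 1) * (\<Prod>w\<leftarrow>vs. x w) = 1 / fact (t - 1) * (\<Prod>w\<in>e - {v}. x w)"
        using prod.distinct_set_conv_list[of vs x] by (simp add: permutations_of_set_def)
    qed
    also have "\<dots> = (\<Prod>w\<in>e - {v}. x w)"
      using e card_e[of e] by (simp add: card_Diff_singleton)
    finally show "(\<Sum>vs\<in>permutations_of_set (e - {v}). 1 / fact (t - 1) * (\<Prod>w\<leftarrow>vs. x w))
        = (\<Prod>w\<in>e - {v}. x w)" .
  qed simp
  finally show ?thesis .
qed

lemma root_prod_le_sum_div_card:
  fixes z :: "'a \<Rightarrow> real"
  assumes "finite S" "S \<noteq> {}" "\<And>i. i \<in> S \<Longrightarrow> z i \<ge> 0"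
  shows "root (card S) (\<Prod>i\<in>S. z i) \<le> (\<Sum>i\<in>S. z i) / card S"
proof -
  have "root (card S) (\<Prod>i\<in>S. z i) = (\<Prod>i\<in>S. z i) powr (1 / card S)"
    using assms by (intro root_powr_inverse) (auto intro: prod_nonneg simp: card_gt_0_iff)
  then show ?thesis
    using arith_geom_mean[OF assms] by (simp add: sum_divide_distrib)
qed

text \<open>The weights need not come from an eigenvector: the incidence weights of a positive
  eigenvector would give equality, and arbitrary ones still give an upper bound, by the
  inequality of arithmetic and geometric means on each edge.\<close>

lemma eigenvalue_bound_of_incidence_weights:
  fixes B :: "'a \<Rightarrow> 'a set \<Rightarrow> real"
  assumes U: "finite U" and t: "t \<ge> 1" and unif: "uniform_hypergraph t E"
    and \<mu>: "tensor_eigenvalue t U (adjacency_tensor t E) \<mu>"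
    and B_nonneg: "\<And>v e. B v e \<ge> 0"
    and vertex_sum: "\<And>v. v \<in> U \<Longrightarrow> (\<Sum>e | e \<in> E \<and> e \<subseteq> U \<and> v \<in> e. B v e) \<le> 1"
    and "\<alpha> \<ge> 0"
    and edge_prod: "\<And>e. \<lbrakk>e \<in> E; e \<subseteq> U\<rbrakk> \<Longrightarrow> \<alpha> \<le> (\<Prod>v\<in>e. B v e)"
  shows "cmod \<mu> * root t \<alpha> \<le> 1"
proof -
  define C where "C = {e \<in> E. e \<subseteq> U}"
  have finC: "finite C" unfolding C_def by (rule finite_subset[of _ "Pow U"]) (use U in auto)
  have C_filter: "{e. e \<in> E \<and> e \<subseteq> U \<and> v \<in> e} = {e \<in> C. v \<in> e}" for v by (auto simp: C_def)
  have card_e: "finite e" "card e = t" "e \<subseteq> U" if "e \<in> C" for e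
    using unif that by (auto simp: uniform_hypergraph_def C_def)
  obtain x where x: "\<exists>v\<in>U. x v \<noteq> 0"
    and eig: "\<And>v. v \<in> U \<Longrightarrow> tensor_apply t U (adjacency_tensor t E) x v = \<mu> * x v ^ (t - 1)"
    using \<mu> unfolding tensor_eigenvalue_def by blast
  define X where "X v = cmod (x v)" for v
  have X_nonneg: "X v \<ge> 0" for v by (simp add: X_def)
  define N where "N = (\<Sum>v\<in>U. X v ^ t)"
  have "N > 0"
  proof -
    obtain v where "v \<in> U" "x v \<noteq> 0" using x by blast
    then show ?thesis unfolding N_def
      by (intro sum_pos2[OF U, of v]) (auto simp: X_def)
  qed
  have in_U: "{v \<in> U. v \<in> e} = e" if "e \<in> C" for e using card_e(3)[OF that] by auto
  have vertex: "cmod \<mu> * X v ^ t \<le> (\<Sum>e | e \<in> C \<and> v \<in> e. \<Prod>w\<in>e. X w)" if "v \<in> U" for v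
  proof -
    have "cmod \<mu> * X v ^ (t - 1) = cmod (\<Sum>e | e \<in> C \<and> v \<in> e. \<Prod>w\<in>e - {v}. x w)"
      using eig[OF that] tensor_apply_adjacency_tensor[OF U that t unif, of x]
      by (simp add: C_filter X_def norm_mult norm_power)
    also have "\<dots> \<le> (\<Sum>e | e \<in> C \<and> v \<in> e. \<Prod>w\<in>e - {v}. X w)"
      unfolding X_def by (rule order_trans[OF norm_sum]) (simp add: prod_norm)
    finally have "X v * (cmod \<mu> * X v ^ (t - 1)) \<le> X v * (\<Sum>e | e \<in> C \<and> v \<in> e. \<Prod>w\<in>e - {v}. X w)"
      using X_nonneg by (intro mult_left_mono) auto
    also have "\<dots> = (\<Sum>e | e \<in> C \<and> v \<in> e. \<Prod>w\<in>e. X w)"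
      unfolding sum_distrib_left
      by (intro sum.cong refl) (use card_e in \<open>auto simp: prod.remove\<close>)
    also have "X v * (cmod \<mu> * X v ^ (t - 1)) = cmod \<mu> * X v ^ t"
      using t by (cases t) auto
    finally show ?thesis .
  qed
  have "cmod \<mu> * N \<le> (\<Sum>v\<in>U. \<Sum>e | e \<in> C \<and> v \<in> e. \<Prod>w\<in>e. X w)"
    unfolding N_def sum_distrib_left by (intro sum_mono vertex)
  also have "\<dots> = (\<Sum>e\<in>C. \<Sum>v | v \<in> U \<and> v \<in> e. \<Prod>w\<in>e. X w)"
    by (rule sum.swap_restrict[OF U finC])
  also have "\<dots> = (\<Sum>e\<in>C. real t * (\<Prod>w\<in>e. X w))"
    by (intro sum.cong) (auto simp: in_U card_e)
  finally have total: "cmod \<mu> * N \<le> (\<Sum>e\<in>C. real t * (\<Prod>w\<in>e. X w))" .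
  have edge: "root t \<alpha> * (real t * (\<Prod>w\<in>e. X w)) \<le> (\<Sum>w\<in>e. B w e * X w ^ t)" if "e \<in> C" for e
  proof -
    have ne: "e \<noteq> {}" using card_e[OF that] t by auto
    have "root t \<alpha> * (\<Prod>w\<in>e. X w) \<le> root t (\<Prod>w\<in>e. B w e) * (\<Prod>w\<in>e. X w)"
      using edge_prod[of e] that t X_nonneg
      by (intro mult_right_mono prod_nonneg) (auto simp: C_def)
    also have "\<dots> = root t (\<Prod>w\<in>e. B w e * X w ^ t)"
      using t X_nonneg
      by (simp add: prod.distrib real_root_mult prod_power_distrib[symmetric]
          real_root_power_cancel prod_nonneg)
    also have "\<dots> \<le> (\<Sum>w\<in>e. B w e * X w ^ t) / t"
      using root_prod_le_sum_div_card[of e "\<lambda>w. B w e * X w ^ t"] card_e[OF that] ne B_nonneg X_nonneg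
      by simp
    finally show ?thesis using t by (simp add: field_simps)
  qed
  have "cmod \<mu> * N * root t \<alpha> \<le> (\<Sum>e\<in>C. real t * (\<Prod>w\<in>e. X w)) * root t \<alpha>"
    using total \<open>\<alpha> \<ge> 0\<close> t by (intro mult_right_mono) auto
  also have "\<dots> = (\<Sum>e\<in>C. root t \<alpha> * (real t * (\<Prod>w\<in>e. X w)))"
    by (subst mult.commute) (rule sum_distrib_left)
  also have "\<dots> \<le> (\<Sum>e\<in>C. \<Sum>w\<in>e. B w e * X w ^ t)" by (intro sum_mono edge)
  also have "\<dots> = (\<Sum>e\<in>C. \<Sum>w | w \<in> U \<and> w \<in> e. B w e * X w ^ t)"
    by (intro sum.cong) (auto simp: in_U)
  also have "\<dots> = (\<Sum>w\<in>U. \<Sum>e | e \<in> C \<and> w \<in> e. B w e * X w ^ t)"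
    by (rule sum.swap_restrict[OF finC U])
  also have "\<dots> = (\<Sum>w\<in>U. (\<Sum>e | e \<in> C \<and> w \<in> e. B w e) * X w ^ t)"
    by (simp add: sum_distrib_right)
  also have "\<dots> \<le> (\<Sum>w\<in>U. 1 * X w ^ t)"
    using vertex_sum X_nonneg by (intro sum_mono mult_right_mono) (auto simp: C_filter)
  finally have "cmod \<mu> * N * root t \<alpha> \<le> N" by (simp add: N_def)
  then have "(cmod \<mu> * root t \<alpha>) * N \<le> 1 * N" by (simp add: mult_ac)
  then show ?thesis using \<open>N > 0\<close> by (simp only: mult_le_cancel_right_pos)
qed

section \<open>The bound for acyclic hypergraphs\<close>

lemma acyclic_eigenvalue_bound:
  fixes t k :: nat
  assumes t: "t \<ge> 2" and k: "k \<ge> 2"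
    and H: "hypergraph V E" and unif: "uniform_hypergraph t E" and acyc: "acyclic_hypergraph V E"
    and deg: "\<forall>v\<in>V. vertex_degree E v \<le> k"
    and U: "finite U" "U \<subseteq> V"
    and \<mu>: "tensor_eigenvalue t U (adjacency_tensor t E) \<mu>"
  shows "cmod \<mu> \<le> real t / (real t - 1) * ((real t - 1) * (real k - 1)) powr (1 / real t)"
proof -
  define C where "C = {e \<in> E. e \<subseteq> U}"
  have finC: "finite C" unfolding C_def by (rule finite_subset[of _ "Pow U"]) (use U in auto)
  have C: "finite e" "card e = t" "e \<subseteq> V" "e \<noteq> {}" if "e \<in> C" for e
    using that unif U t by (auto simp: C_def uniform_hypergraph_def)
  have "C \<subseteq> E" by (auto simp: C_def)
  obtain p where p: "\<And>e. e \<in> C \<Longrightarrow> p e \<in> e"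
    and one_parent: "\<And>e f v. \<lbrakk>e \<in> C; f \<in> C; e \<noteq> f; v \<in> e; v \<in> f\<rbrakk> \<Longrightarrow> p e = v \<or> p f = v"
  proof -
    have "\<exists>p. (\<forall>e\<in>C. p e \<in> e) \<and>
        (\<forall>e\<in>C. \<forall>f\<in>C. \<forall>v. e \<noteq> f \<longrightarrow> v \<in> e \<longrightarrow> v \<in> f \<longrightarrow> p e = v \<or> p f = v)"
      by (rule acyclic_parent_map[OF acyc finC \<open>C \<subseteq> E\<close>]) (use C in auto)
    then show ?thesis using that by metis
  qed
  \<comment> \<open>Subject to \<open>a + (k - 1) b = 1\<close>, this choice maximises the product \<open>b a\<^sup>t\<^sup>-\<^sup>1\<close> of an edge.\<close>
  define a b :: real where "a = (real t - 1) / t" and "b = 1 / (t * (real k - 1))"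
  have ab: "a \<ge> 0" "b > 0" "a + (real k - 1) * b = 1"
    using t k by (auto simp: a_def b_def field_simps)
  \<comment> \<open>This is the weight at a root of degree \<open>k\<close>.\<close>
  have kb: "k * b \<le> 1"
  proof -
    have "2 * (real k - 1) \<le> t * (real k - 1)" using t k by (intro mult_right_mono) auto
    then show ?thesis using t k by (simp add: b_def divide_le_eq)
  qed
  define B where "B v e = (if v = p e then b else a)" for v e
  have "cmod \<mu> * root t (b * a ^ (t - 1)) \<le> 1"
  proof (rule eigenvalue_bound_of_incidence_weights[OF U(1) _ unif \<mu>, where B = B])
    show "t \<ge> 1" using t by simp
    show "B v e \<ge> 0" for v e using ab by (simp add: B_def)
    show "b * a ^ (t - 1) \<ge> 0" using ab by simp
    show "b * a ^ (t - 1) \<le> (\<Prod>v\<in>e. B v e)" if "e \<in> E" "e \<subseteq> U" for e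
    proof -
      have e: "e \<in> C" using that by (simp add: C_def)
      have "(\<Prod>v\<in>e. B v e) = B (p e) e * (\<Prod>v\<in>e - {p e}. B v e)"
        using e C p by (intro prod.remove) auto
      also have "(\<Prod>v\<in>e - {p e}. B v e) = (\<Prod>v\<in>e - {p e}. a)"
        by (intro prod.cong) (auto simp: B_def)
      also have "\<dots> = a ^ (t - 1)" using e C p by (simp add: card_Diff_singleton)
      finally show ?thesis by (simp add: B_def)
    qed
    show "(\<Sum>e | e \<in> E \<and> e \<subseteq> U \<and> v \<in> e. B v e) \<le> 1" if v: "v \<in> U" for v
    proof -
      define D where "D = {e \<in> C. v \<in> e}"
      have D_eq: "{e. e \<in> E \<and> e \<subseteq> U \<and> v \<in> e} = D" by (auto simp: C_def D_def)
      have finD: "finite D" using finC by (simp add: D_def)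
      have "v \<in> V" using v U by blast
      have "card D \<le> vertex_degree E v"
        unfolding vertex_degree_def using hypergraph.locally_finite[OF H \<open>v \<in> V\<close>]
        by (intro card_mono) (auto simp: D_def C_def)
      then have cardD: "card D \<le> k" using deg \<open>v \<in> V\<close> by force
      have "(\<Sum>e\<in>D. B v e) \<le> 1"
      proof (cases "\<exists>e\<in>D. p e \<noteq> v")
        case True
        then obtain e where e: "e \<in> D" "p e \<noteq> v" by blast
        have "(\<Sum>e\<in>D. B v e) = B v e + (\<Sum>f\<in>D - {e}. B v f)"
          using e finD by (intro sum.remove) auto
        also have "(\<Sum>f\<in>D - {e}. B v f) = (\<Sum>f\<in>D - {e}. b)"
          using one_parent[of e _ v] e by (intro sum.cong) (auto simp: B_def D_def)
        also have "\<dots> = (real (card D) - 1) * b"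
          using e finD card_gt_0_iff[of D] by (auto simp: card_Diff_singleton of_nat_diff)
        also have "B v e + \<dots> \<le> a + (real k - 1) * b"
          using e cardD ab(2) by (intro add_mono mult_right_mono) (auto simp: B_def)
        finally show ?thesis using ab by simp
      next
        case False
        then have "(\<Sum>e\<in>D. B v e) = card D * b" by (simp add: B_def)
        also have "\<dots> \<le> k * b" using cardD ab by (intro mult_right_mono) auto
        finally show ?thesis using kb by simp
      qed
      then show ?thesis by (simp add: D_eq)
    qed
  qed
  also have "root t (b * a ^ (t - 1)) = a / ((real t - 1) * (real k - 1)) powr (1 / real t)"
  proof -
    have "b * a ^ (t - 1) = a ^ t / ((real t - 1) * (real k - 1))"
    proof -
      have "real t - 1 \<noteq> 0" using t by simp
      then have "b = a / ((real t - 1) * (real k - 1))" by (simp add: a_def b_def)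
      then show ?thesis using t by (cases t) auto
    qed
    then have "root t (b * a ^ (t - 1)) = root t (a ^ t) / root t ((real t - 1) * (real k - 1))"
      by (simp add: real_root_divide)
    also have "root t (a ^ t) = a" using ab t by (simp add: real_root_power_cancel)
    also have "root t ((real t - 1) * (real k - 1)) = ((real t - 1) * (real k - 1)) powr (1 / real t)"
      using t k by (intro root_powr_inverse) auto
    finally show ?thesis .
  qed
  finally have "cmod \<mu> * (a / ((real t - 1) * (real k - 1)) powr (1 / real t)) \<le> 1" .
  moreover have "((real t - 1) * (real k - 1)) powr (1 / real t) > 0" "a > 0"
    using t k by (auto simp: a_def)
  ultimately have "cmod \<mu> \<le> ((real t - 1) * (real k - 1)) powr (1 / real t) / a"
    by (simp add: pos_le_divide_eq pos_divide_le_eq)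
  then show ?thesis by (simp add: a_def mult.commute)
qed

theorem corollary3p4:
  fixes V :: "'a set" and E :: "'a set set" and t k :: nat
  assumes "t \<ge> 2" and "k \<ge> 2"
    and "hypergraph V E"
    and "uniform_hypergraph t E"
    and "acyclic_hypergraph V E"
    and "\<forall>v\<in>V. vertex_degree E v \<le> k"
  shows "hypergraph_spectral_radius t V E \<le>
    ennreal (real t / (real t - 1) * ((real t - 1) * (real k - 1)) powr (1 / real t))"
proof -
  have "spectral_radius_finite t U (adjacency_tensor t E) \<le>
      ennreal (real t / (real t - 1) * ((real t - 1) * (real k - 1)) powr (1 / real t))"
    if "finite U" "U \<subseteq> V" for U
    unfolding spectral_radius_finite_def
    using acyclic_eigenvalue_bound[OF assms that] by (auto intro!: SUP_least ennreal_leI)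
  then show ?thesis
    unfolding hypergraph_spectral_radius_def spectral_radius_def by (auto intro!: SUP_least)
qed

end
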